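(* Let $G$ be a connected strongly regular graph with parameters $(n,k,a,c)$ which is not complete and has $k\ge 3$. Suppose a terminating chip-firing game with $N$ chips was played on $G$ and let $s$ be the total number of firings. Then $$ s \leq n\frac{k-1}{k-2}+\frac{2(2N-k+1)}{c}.$$
   Context: A strongly regular graph with parameters $(n,k,a,c)$ is a $k$-regular simple graph on $n$ vertices such that any two adjacent vertices have exactly $a$ common neighbours and any two distinct non-adjacent vertices have exactly $c$ common neighbours; connectedness of a non-complete such graph gives $c\ge1$. Chip-firing game: a configuration is a vector $\mathbf a\in\mathbb Z_{\ge 0}^n$ ($a_i$ chips on vertex $i$), with $N=\sum_i a_i$ chips. Vertex $i$ may fire if $a_i\ge k$; firing moves one chip from $i$ to each neighbour of $i$. A terminating game is a finite sequence of legal firings from an initial configuration ending in a configuration in which no vertex can fire; $s$ is the length of this sequence. *)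

theory Defs
  imports Complex_Main "Graph_Theory.Graph_Theory"
begin

text \<open>
  A simple undirected graph is rendered by the library locale \<^locale>\<open>graph\<close>: a finite symmetric
  digraph without loops and parallel arcs, each edge being a pair of opposite arcs. Hence
  \<^const>\<open>out_degree\<close> is the usual vertex degree.
\<close>

definition common_neighbours :: "('a, 'b) pre_digraph \<Rightarrow> 'a \<Rightarrow> 'a \<Rightarrow> 'a set" where
  "common_neighbours G u v = {w \<in> verts G. u \<rightarrow>\<^bsub>G\<^esub> w \<and> v \<rightarrow>\<^bsub>G\<^esub> w}"

definition strongly_regular ::
    "('a, 'b) pre_digraph \<Rightarrow> nat \<Rightarrow> nat \<Rightarrow> nat \<Rightarrow> nat \<Rightarrow> bool" where
  "strongly_regular G n k a c \<longleftrightarrow>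
     graph G \<and> card (verts G) = n \<and>
     (\<forall>v \<in> verts G. out_degree G v = k) \<and>
     (\<forall>u \<in> verts G. \<forall>v \<in> verts G.
        u \<rightarrow>\<^bsub>G\<^esub> v \<longrightarrow> card (common_neighbours G u v) = a) \<and>
     (\<forall>u \<in> verts G. \<forall>v \<in> verts G.
        u \<noteq> v \<and> \<not> u \<rightarrow>\<^bsub>G\<^esub> v \<longrightarrow> card (common_neighbours G u v) = c)"

text \<open>
  A configuration is a function \<open>x :: 'a \<Rightarrow> nat\<close>, of which only the values on \<^term>\<open>verts G\<close> matter.
\<close>

definition may_fire :: "('a, 'b) pre_digraph \<Rightarrow> nat \<Rightarrow> ('a \<Rightarrow> nat) \<Rightarrow> 'a \<Rightarrow> bool" where
  "may_fire G k x i \<longleftrightarrow> i \<in> verts G \<and> k \<le> x i"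

text \<open>
  The subtraction on \<^typ>\<open>nat\<close> is exact for legal firings on a \<open>k\<close>-regular graph.
\<close>

definition fire :: "('a, 'b) pre_digraph \<Rightarrow> ('a \<Rightarrow> nat) \<Rightarrow> 'a \<Rightarrow> ('a \<Rightarrow> nat)" where
  "fire G x i = (\<lambda>j. if j = i then x j - out_degree G i
                     else if i \<rightarrow>\<^bsub>G\<^esub> j then x j + 1
                     else x j)"

inductive legal_game ::
    "('a, 'b) pre_digraph \<Rightarrow> nat \<Rightarrow> ('a \<Rightarrow> nat) \<Rightarrow> 'a list \<Rightarrow> ('a \<Rightarrow> nat) \<Rightarrow> bool"
  for G :: "('a, 'b) pre_digraph" and k :: nat where
  Nil: "legal_game G k x [] x"
| Cons: "may_fire G k x i \<Longrightarrow> legal_game G k (fire G x i) is y \<Longrightarrow> legal_game G k x (i # is) y"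

definition terminating_game ::
    "('a, 'b) pre_digraph \<Rightarrow> nat \<Rightarrow> ('a \<Rightarrow> nat) \<Rightarrow> 'a list \<Rightarrow> bool" where
  "terminating_game G k x is \<longleftrightarrow>
     (\<exists>y. legal_game G k x is y \<and> (\<forall>i \<in> verts G. \<not> may_fire G k y i))"

end

theory Submission
  imports Defs
begin

text \<open>
  Let \<open>f\<close> count the firings of each vertex. Some vertex \<open>v\<close> never fires: otherwise take the vertex
  whose last firing comes first; afterwards all its neighbours fire, so it ends with at least \<open>k\<close>
  chips. Evaluating the identity \<open>A\<^sup>2 f = (k - c) f + (a - c) A f + c J f\<close> for the adjacency matrix
  at \<open>v\<close>, where \<open>f v = 0\<close> and \<open>J f = s\<close>, expresses \<open>c s\<close> through the initial and final
  configurations on \<open>v\<close> and its neighbours. With \<open>k (k - a - 1) = c (n - k - 1)\<close> this gives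
  \<open>s \<le> (n - 1) (k - 1) / k + N / c\<close>, which is stronger than the claim as soon as one vertex fires.
\<close>

section \<open>Neighbourhoods and double counting\<close>

definition neighbours :: "('a, 'b) pre_digraph \<Rightarrow> 'a \<Rightarrow> 'a set" where
  "neighbours G v = {w \<in> verts G. v \<rightarrow>\<^bsub>G\<^esub> w}"

lemma in_neighbours_iff [simp]: "w \<in> neighbours G v \<longleftrightarrow> w \<in> verts G \<and> v \<rightarrow>\<^bsub>G\<^esub> w"
  by (simp add: neighbours_def)

lemma (in fin_digraph) finite_neighbours [simp]: "finite (neighbours G v)"
  by (simp add: neighbours_def)

lemma (in graph) dominates_commute: "u \<rightarrow> v \<longleftrightarrow> v \<rightarrow> u"
  using arcs_ends_symmetric[OF sym_arcs] by blast

text \<open>\<open>out_degree\<close> counts arcs; without parallel arcs, \<open>head\<close> is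
  injective on those leaving \<open>v\<close>.\<close>

lemma (in graph) card_neighbours: "card (neighbours G v) = out_degree G v"
proof -
  have "bij_betw (head G) (out_arcs G v) (neighbours G v)"
  proof (rule bij_betw_imageI)
    show "inj_on (head G) (out_arcs G v)"
      by (rule inj_onI) (auto intro!: no_multi_arcs simp: arc_to_ends_def)
    show "head G ` out_arcs G v = neighbours G v"
      by (force simp: arcs_ends_conv)
  qed
  then show ?thesis
    by (simp add: out_degree_def bij_betw_same_card)
qed

lemma (in graph) sum_neighbours_swap:
  fixes g :: "'a \<Rightarrow> 'c :: comm_semiring_1"
  assumes "S \<subseteq> verts G"
  shows "(\<Sum>u\<in>S. \<Sum>w\<in>neighbours G u. g w)
       = (\<Sum>w\<in>verts G. of_nat (card {u \<in> S. u \<rightarrow> w}) * g w)"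
proof -
  have "finite S"
    using finite_subset[OF assms finite_verts] .
  have "(\<Sum>u\<in>S. \<Sum>w\<in>neighbours G u. g w) = (\<Sum>w\<in>verts G. \<Sum>u\<in>{u \<in> S. u \<rightarrow> w}. g w)"
    unfolding neighbours_def using \<open>finite S\<close> by (intro sum.swap_restrict) auto
  then show ?thesis
    by simp
qed

section \<open>Chip-firing on a regular graph\<close>

context graph
begin

context
  fixes k :: nat
  assumes regular: "\<And>v. v \<in> verts G \<Longrightarrow> out_degree G v = k"
begin

text \<open>Each firing of \<open>j\<close> costs it \<open>k\<close> chips and each firing of a
  neighbour brings it one. Losses stand on the left so that no subtraction occurs.\<close>

lemma legal_game_chips:
  assumes "legal_game G k x is y" "j \<in> verts G"
  shows "int (y j) + int k * int (count_list is j)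
       = int (x j) + (\<Sum>i\<in>neighbours G j. int (count_list is i))"
  using assms(1)
proof induction
  case (Nil x)
  then show ?case by simp
next
  case (Cons x i "is" y)
  have i: "i \<in> verts G" "k \<le> x i"
    using Cons.hyps(1) by (auto simp: may_fire_def)
  have "(\<Sum>u\<in>neighbours G j. int (count_list (i # is) u))
      = (\<Sum>u\<in>neighbours G j. (if u = i then 1 else 0) + int (count_list is u))"
    by (rule sum.cong) auto
  also have "\<dots> = (if i \<rightarrow> j then 1 else 0) + (\<Sum>u\<in>neighbours G j. int (count_list is u))"
    using i by (simp add: sum.distrib dominates_commute)
  finally show ?case
    using Cons.IH i regular[OF i(1)] adj_not_same[of i]
    by (auto simp: fire_def of_nat_diff algebra_simps split: if_splits)
qed

lemma legal_game_fires_in_verts: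
  assumes "legal_game G k x is y"
  shows "set is \<subseteq> verts G"
  using assms by induction (auto simp: may_fire_def)

lemma legal_game_sum_chips:
  assumes "legal_game G k x is y"
  shows "sum y (verts G) = sum x (verts G)"
proof -
  let ?f = "\<lambda>i. int (count_list is i)"
  have deg: "card {u \<in> verts G. u \<rightarrow> w} = k" if "w \<in> verts G" for w
    using card_neighbours[of w] regular[OF that] by (simp add: neighbours_def dominates_commute)
  have "(\<Sum>j\<in>verts G. int (y j) + int k * ?f j)
      = (\<Sum>j\<in>verts G. int (x j) + (\<Sum>i\<in>neighbours G j. ?f i))"
    by (rule sum.cong) (auto simp: legal_game_chips[OF assms])
  moreover have "(\<Sum>j\<in>verts G. \<Sum>i\<in>neighbours G j. ?f i) = (\<Sum>j\<in>verts G. int k * ?f j)"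
    by (subst sum_neighbours_swap) (auto simp: deg)
  ultimately have "int (sum y (verts G)) = int (sum x (verts G))"
    by (simp add: sum.distrib)
  then show ?thesis
    by (simp only: of_nat_eq_iff)
qed

text \<open>Induction on the game locates the vertex whose last firing comes first: it is the head
  of the first suffix in which the head does not recur.\<close>

lemma legal_game_all_fire_not_stuck:
  assumes "legal_game G k x is y" "verts G \<subseteq> set is" "verts G \<noteq> {}"
  shows "\<exists>v\<in>verts G. may_fire G k y v"
  using assms
proof induction
  case (Nil x)
  then show ?case by simp
next
  case (Cons x i "is" y)
  show ?case
  proof (cases "i \<in> set is")
    case True
    then show ?thesis
      using Cons by auto
  next
    case False
    have i: "i \<in> verts G"
      using Cons.hyps(1) by (simp add: may_fire_def)
    have "u \<in> set is" if "u \<in> neighbours G i" for u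
      using that Cons.prems adj_not_same by auto
    then have "1 \<le> int (count_list is u)" if "u \<in> neighbours G i" for u
      using that by (metis count_list_0_iff int_one_le_iff_zero_less neq0_conv of_nat_0_less_iff)
    then have "(\<Sum>u\<in>neighbours G i. 1) \<le> (\<Sum>u\<in>neighbours G i. int (count_list is u))"
      by (intro sum_mono) auto
    \<comment> \<open>The balance is taken over the tail, where \<open>i\<close> never fires and
      each of its \<open>k\<close> neighbours fires at least once.\<close>
    then have "int k \<le> int (y i)"
      using legal_game_chips[OF Cons.hyps(2) i] False card_neighbours[of i] regular[OF i] by simp
    then show ?thesis
      using i by (auto simp: may_fire_def)
  qed
qed

end

end

section \<open>Strongly regular graphs\<close>

text \<open>This is the entry at \<open>v\<close> of the identity for the squared adjacency matrix:
  from \<open>v\<close> to \<open>w\<close> there are \<open>k\<close>, \<open>a\<close> or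
  \<open>c\<close> walks of length two, according as \<open>w\<close> is \<open>v\<close>, a
  neighbour of \<open>v\<close>, or neither.\<close>

lemma strongly_regular_sum_neighbours:
  fixes g :: "'a \<Rightarrow> int"
  assumes "strongly_regular G n k a c" "v \<in> verts G"
  shows "(\<Sum>u\<in>neighbours G v. \<Sum>w\<in>neighbours G u. g w)
       = int k * g v + int a * (\<Sum>w\<in>neighbours G v. g w)
         + int c * ((\<Sum>w\<in>verts G. g w) - g v - (\<Sum>w\<in>neighbours G v. g w))"
proof -
  interpret graph G
    using assms by (simp add: strongly_regular_def)
  have common: "{u \<in> neighbours G v. u \<rightarrow>\<^bsub>G\<^esub> w} = common_neighbours G v w" for w
    by (auto simp: common_neighbours_def dominates_commute)
  have self: "common_neighbours G v v = neighbours G v"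
    by (auto simp: common_neighbours_def)
  have "card (common_neighbours G v w)
      = (if w = v then k else if w \<in> neighbours G v then a else c)" if "w \<in> verts G" for w
    using assms that card_neighbours[of v] by (auto simp: strongly_regular_def self)
  moreover have sub: "neighbours G v \<subseteq> verts G"
    by auto
  ultimately have "(\<Sum>u\<in>neighbours G v. \<Sum>w\<in>neighbours G u. g w)
      = (\<Sum>w\<in>verts G. int (if w = v then k else if w \<in> neighbours G v then a else c) * g w)"
    unfolding sum_neighbours_swap[OF sub] common by (intro sum.cong) simp_all
  \<comment> \<open>Start from the coefficient \<open>c\<close> everywhere and correct it at
    \<open>v\<close> and on its neighbours; without loops the two corrections never overlap.\<close>
  also have "\<dots> = (\<Sum>w\<in>verts G. (if w = v then (int k - int c) * g w else 0)
      + (if w \<in> neighbours G v then (int a - int c) * g w else 0) + int c * g w)"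
    using adj_not_same by (intro sum.cong) (auto simp: algebra_simps)
  also have "\<dots> = (int k - int c) * g v + (int a - int c) * (\<Sum>w\<in>neighbours G v. g w)
      + int c * (\<Sum>w\<in>verts G. g w)"
  proof -
    have "verts G \<inter> neighbours G v = neighbours G v"
      by auto
    then have "(\<Sum>w\<in>verts G. if w \<in> neighbours G v then (int a - int c) * g w else 0)
        = (\<Sum>w\<in>neighbours G v. (int a - int c) * g w)"
      using sum.inter_restrict[OF finite_verts, of "\<lambda>w. (int a - int c) * g w" "neighbours G v"]
      by (simp only:)
    then show ?thesis
      using assms(2) by (simp add: sum.distrib sum_distrib_left del: in_neighbours_iff)
  qed
  finally show ?thesis
    by (simp add: algebra_simps)
qed

text \<open>Apply the walk-counting identity to the constant function 1.\<close>

lemma strongly_regular_parameters: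
  assumes "strongly_regular G n k a c" "v \<in> verts G"
  shows "int k * (int k - int a - 1) = int c * (int n - int k - 1)"
proof -
  interpret graph G
    using assms by (simp add: strongly_regular_def)
  have deg: "card (neighbours G u) = k" if "u \<in> verts G" for u
    using assms that by (simp add: strongly_regular_def card_neighbours)
  have "int k * int k = int k + int a * int k + int c * (int n - 1 - int k)"
    using strongly_regular_sum_neighbours[OF assms, of "\<lambda>_. 1"] assms
    by (simp add: deg strongly_regular_def)
  then show ?thesis
    by (simp add: algebra_simps)
qed

text \<open>If \<open>c = 0\<close>, vertices at distance two cannot exist, so being equal or
  adjacent to \<open>v\<close> propagates along walks and connectedness forces completeness.\<close>

lemma strongly_regular_connected_pos:
  assumes "strongly_regular G n k a c" "Digraph_Component.connected G" "\<not> complete_digraph n G"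
  shows "0 < c"
proof (rule ccontr)
  assume "\<not> 0 < c"
  interpret graph G
    using assms by (simp add: strongly_regular_def)
  have "v = w \<or> v \<rightarrow>\<^bsub>G\<^esub> w" if "v \<in> verts G" "w \<in> verts G" for v w
  proof -
    have "v \<rightarrow>\<^sup>*\<^bsub>G\<^esub> w"
      using symmetric_connected_imp_strongly_connected[OF sym_arcs assms(2)] that by auto
    then have "(v, w) \<in> (arcs_ends G)\<^sup>*"
      by (rule reachable_rtranclI)
    then show ?thesis
    proof induction
      case base
      then show ?case by simp
    next
      case (step u w)
      show ?case
      proof (rule ccontr)
        assume *: "\<not> (v = w \<or> v \<rightarrow>\<^bsub>G\<^esub> w)"
        then have "card (common_neighbours G v w) = 0"
          using assms(1) that(1) adj_in_verts[OF step.hyps(2)] \<open>\<not> 0 < c\<close>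
          by (auto simp: strongly_regular_def)
        moreover have "u \<in> common_neighbours G v w"
          using * step adj_in_verts dominates_commute by (auto simp: common_neighbours_def)
        moreover have "finite (common_neighbours G v w)"
          by (simp add: common_neighbours_def)
        ultimately show False
          by auto
      qed
    qed
  qed
  then have "arcs_ends G = {(u, v). (u, v) \<in> verts G \<times> verts G \<and> u \<noteq> v}"
    using adj_in_verts adj_not_same by auto
  then show False
    using assms by (auto simp: complete_digraph_def strongly_regular_def)
qed

text \<open>Two distinct non-adjacent vertices and the \<open>k\<close> neighbours of one of them
  are \<open>k + 2\<close> different vertices, or at least \<open>k + 2\<close> if counted in
  \<open>G\<close>.\<close>

lemma strongly_regular_not_complete_order:
  assumes "strongly_regular G n k a c" "\<not> complete_digraph n G"
  shows "k + 2 \<le> n"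
proof -
  interpret graph G
    using assms by (simp add: strongly_regular_def)
  obtain u v where uv: "u \<in> verts G" "v \<in> verts G" "u \<noteq> v" "\<not> u \<rightarrow>\<^bsub>G\<^esub> v"
  proof (rule ccontr)
    assume "\<not> thesis"
    with that have "arcs_ends G = {(u, v). (u, v) \<in> verts G \<times> verts G \<and> u \<noteq> v}"
      using adj_in_verts adj_not_same by auto
    then show False
      using assms by (auto simp: complete_digraph_def strongly_regular_def)
  qed
  have "card (insert u (insert v (neighbours G u))) \<le> card (verts G)"
    using uv by (intro card_mono) auto
  moreover have "card (neighbours G u) = k" "card (verts G) = n"
    using assms(1) uv(1) card_neighbours[of u] by (auto simp: strongly_regular_def)
  moreover have "u \<notin> neighbours G u"
    using adj_not_same[of u] by auto
  ultimately show ?thesis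
    using uv by simp
qed

lemma strongly_regular_game_length:
  assumes srg: "strongly_regular G n k a c"
    and "verts G \<noteq> {}" "0 < k" "a < k"
    and "terminating_game G k x is"
  shows "int c * int (length is)
       \<le> (int k + int c - int a - 1) * (int k - 1) + int (\<Sum>i\<in>verts G. x i)"
proof -
  interpret graph G
    using srg by (simp add: strongly_regular_def)
  have reg: "\<And>v. v \<in> verts G \<Longrightarrow> out_degree G v = k"
    using srg by (simp add: strongly_regular_def)
  obtain y where y: "legal_game G k x is y" "\<And>i. i \<in> verts G \<Longrightarrow> y i < k"
    using assms(5) by (auto simp: terminating_game_def may_fire_def not_le)
  then obtain v where v: "v \<in> verts G" "v \<notin> set is"
    using legal_game_all_fire_not_stuck[OF reg y(1)] assms(2) by (fastforce simp: may_fire_def)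
  let ?f = "\<lambda>i. int (count_list is i)"
  let ?M = "neighbours G v"
  let ?F = "\<Sum>w\<in>?M. ?f w"
  \<comment> \<open>As \<open>v\<close> never fires, its gain in chips counts all firings of its
    neighbours.\<close>
  have F: "int (y v) = int (x v) + ?F"
    using legal_game_chips[OF reg y(1) v(1)] v(2) by simp
  have len: "(\<Sum>w\<in>verts G. ?f w) = int (length is)"
    using sum_count_set[OF legal_game_fires_in_verts[OF reg y(1)] finite_verts]
    by (simp flip: of_nat_sum)
  have "(\<Sum>u\<in>?M. int (y u) + int k * ?f u) = (\<Sum>u\<in>?M. int (x u) + (\<Sum>w\<in>neighbours G u. ?f w))"
    by (rule sum.cong) (auto simp: legal_game_chips[OF reg y(1)])
  then have "(\<Sum>u\<in>?M. int (y u)) + int k * ?F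
      = (\<Sum>u\<in>?M. int (x u)) + (int a * ?F + int c * (int (length is) - ?F))"
    using strongly_regular_sum_neighbours[OF srg v(1), of ?f] v(2) len
    by (simp add: sum.distrib sum_distrib_left)
  then have "int c * int (length is) = (int k + int c - int a) * ?F
      + (\<Sum>u\<in>?M. int (y u)) - (\<Sum>u\<in>?M. int (x u))"
    by (simp add: algebra_simps)
  also have "\<dots> \<le> (int k + int c - int a) * int (y v) + (\<Sum>u\<in>?M. int (y u))"
  proof -
    have "(int k + int c - int a) * ?F \<le> (int k + int c - int a) * int (y v)"
      using F assms(4) by (intro mult_left_mono) auto
    moreover have "0 \<le> (\<Sum>u\<in>?M. int (x u))"
      by (intro sum_nonneg) auto
    ultimately show ?thesis
      by linarith
  qed
  \<comment> \<open>One copy of \<open>y v\<close> completes the sum to the closed neighbourhood of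
    \<open>v\<close>, whose chips are at most the total; the other copies are bounded by
    \<open>y v \<le> k - 1\<close>.\<close>
  also have "\<dots> = (int k + int c - int a - 1) * int (y v) + (\<Sum>u\<in>insert v ?M. int (y u))"
  proof -
    have "v \<notin> ?M"
      using adj_not_same[of v] by auto
    then show ?thesis
      by (simp add: algebra_simps del: in_neighbours_iff)
  qed
  also have "\<dots> \<le> (int k + int c - int a - 1) * (int k - 1) + (\<Sum>u\<in>verts G. int (y u))"
    using y(2)[OF v(1)] assms(4) v(1) by (intro add_mono mult_left_mono sum_mono2) auto
  also have "(\<Sum>u\<in>verts G. int (y u)) = int (\<Sum>i\<in>verts G. x i)"
    using legal_game_sum_chips[OF reg y(1)] by (simp flip: of_nat_sum)
  finally show ?thesis .
qed

theorem mainTheorem10: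
  fixes G :: "('a, 'b) pre_digraph"
    and n k a c N s :: nat
    and x :: "'a \<Rightarrow> nat"
    and firings :: "'a list"
  assumes "strongly_regular G n k a c"
    and "Digraph_Component.connected G"
    and "\<not> complete_digraph n G"
    and "k \<ge> 3"
    and "terminating_game G k x firings"
    and "N = (\<Sum>i\<in>verts G. x i)"
    and "s = length firings"
  shows "real s \<le> real n * ((real k - 1) / (real k - 2))
                   + 2 * (2 * real N - real k + 1) / real c"
proof -
  interpret graph G
    using assms(1) by (simp add: strongly_regular_def)
  have c: "0 < c"
    using strongly_regular_connected_pos assms by blast
  have n: "k + 2 \<le> n"
    using strongly_regular_not_complete_order assms by blast
  have ne: "verts G \<noteq> {}"
    using assms(2) by (simp add: connected_conv)
  then have par: "int k * (int k - int a - 1) = int c * (int n - int k - 1)"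
    using strongly_regular_parameters[OF assms(1)] by blast
  have "0 < int c * (int n - int k - 1)"
    using c n by simp
  then have "0 < int k * (int k - int a - 1)"
    by (simp only: par)
  then have a: "a + 1 < k"
    using assms(4) by (simp add: zero_less_mult_iff)
  have par': "real k * (real k - real a - 1) = real c * (real n - real k - 1)"
    using arg_cong[OF par, of real_of_int] by simp
  \<comment> \<open>The parameter identity gives \<open>n c = k (k - a - 1) + c k + c\<close>, and
    the first two terms are each at least \<open>k\<close>.\<close>
  have bound: "2 * real k - 3 \<le> real n * real c"
  proof -
    have "real k * 1 \<le> real k * (real k - real a - 1)"
      using a by (intro mult_left_mono) auto
    moreover have "real k * 1 \<le> real k * real c"
      using c by (intro mult_left_mono) auto
    ultimately show ?thesis
      using par' c by (simp add: algebra_simps)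
  qed
  show ?thesis
  proof (cases "firings = []")
    case True
    \<comment> \<open>With no firings \<open>N\<close> may be 0, so the first term of the bound must
      outweigh a second term as low as \<open>- 2 (k - 1) / c\<close>.\<close>
    have "2 * (real k - 1) / real c \<le> real n * ((real k - 1) / (real k - 2))"
    proof -
      have "2 * (real k - 2) \<le> real n * real c"
        using bound by simp
      then have "2 * (real k - 2) * (real k - 1) \<le> real n * real c * (real k - 1)"
        using assms(4) by (intro mult_right_mono) auto
      then show ?thesis
        using c assms(4) by (simp add: field_simps)
    qed
    moreover have "- (2 * (real k - 1) / real c) \<le> 2 * (2 * real N - real k + 1) / real c"
      unfolding minus_divide_left by (rule divide_right_mono) auto
    ultimately show ?thesis
      using True assms(7) by simp
  next
    case False
    \<comment> \<open>The first firing needs \<open>k\<close> chips on one vertex; hence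
      \<open>N \<le> 2 (2 N - k + 1)\<close>, as the last comparison requires.\<close>
    have "k \<le> N"
    proof -
      obtain i where i: "may_fire G k x i"
        using assms(5) False by (auto simp: terminating_game_def elim: legal_game.cases)
      then have "x i \<le> N"
        unfolding assms(6) may_fire_def by (intro member_le_sum) auto
      then show ?thesis
        using i by (simp add: may_fire_def)
    qed
    have "int c * int s \<le> (int k + int c - int a - 1) * (int k - 1) + int N"
      using strongly_regular_game_length[OF assms(1) ne _ _ assms(5)] assms(4,6,7) a by simp
    then have "real_of_int (int c * int s)
        \<le> real_of_int ((int k + int c - int a - 1) * (int k - 1) + int N)"
      by (simp only: of_int_le_iff)
    then have "real c * real s \<le> (real k + real c - real a - 1) * (real k - 1) + real N"
      by simp
    \<comment> \<open>The factor \<open>k\<close> creates \<open>k (k - a - 1)\<close>, which the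
      parameter identity replaces by \<open>c (n - k - 1)\<close>, eliminating
      \<open>a\<close>.\<close>
    then have "real k * (real c * real s)
        \<le> real k * ((real k + real c - real a - 1) * (real k - 1) + real N)"
      by (rule mult_left_mono) simp
    also have "\<dots> = (real k * (real k - real a - 1)) * (real k - 1)
        + real k * real c * (real k - 1) + real k * real N"
      by (simp add: algebra_simps)
    also have "\<dots> = real k * real c * ((real n - 1) * ((real k - 1) / real k) + real N / real c)"
      unfolding par' using c assms(4) by (simp add: field_simps)
    finally have "real s \<le> (real n - 1) * ((real k - 1) / real k) + real N / real c"
      using c assms(4) by (simp add: mult.assoc)
    also have "\<dots> \<le> real n * ((real k - 1) / (real k - 2))
        + 2 * (2 * real N - real k + 1) / real c"
      using \<open>k \<le> N\<close> n c assms(4)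
      by (intro add_mono mult_mono divide_left_mono divide_right_mono) auto
    finally show ?thesis .
  qed
qed

end
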